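(* Each terminating TRS is an EPRF-TRS.
   Context: A ranked alphabet is a finite set of symbols with ranks; $X$ a countable set of variables, $T_\Sigma(X)$ the terms, $T_\Sigma$ the ground terms. A TRS $R$ is a finite set of rules $l\to r$, $l,r\in T_\Sigma(X)$, with every variable of $r$ occurring in $l$; $sign(R)$ is the set of symbols in its rules; $R$ is terminating if there is no infinite rewrite sequence. $R^*_\Sigma(L)=\{p\mid q\Rightarrow^*_R p,\ q\in L\}$. A bottom-up tree automaton (bta) over $\Sigma$ is a finite automaton with states (treated as constants), final states, rules $\delta(a_1,\dots,a_n)\to a$ and $a\to a'$, recognizing the ground terms rewriting to a final state. $R$ is an EPRF-TRS if for any given ranked alphabet $\Sigma\supseteq sign(R)$ and finite $L\subseteq T_\Sigma$ one can effectively construct a bta $\mathcal{C}$ over $\Sigma$ with $L(\mathcal{C})=R^*_\Sigma(L)$. *)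

theory Defs
  imports Main "HOL-Library.Nat_Bijection"
begin

section \<open>Terms over ranked alphabets\<close>

text \<open>
  A symbol is a pair of a name and a rank, so every symbol carries its unique rank.  A ranked
  alphabet is any finite set of symbols.  Names are natural numbers, so that finite alphabets,
  sets of terms and automata can be inputs and outputs of recursive functions.
\<close>

type_synonym symb = "nat \<times> nat"

abbreviation rank :: "symb \<Rightarrow> nat" where
  "rank f \<equiv> snd f"

datatype trm = Var nat | Fun symb "trm list"

primrec vars :: "trm \<Rightarrow> nat set" where
  "vars (Var x) = {x}"
| "vars (Fun f ts) = \<Union> (set (map vars ts))"

primrec symbols :: "trm \<Rightarrow> symb set" where
  "symbols (Var x) = {}"
| "symbols (Fun f ts) = insert f (\<Union> (set (map symbols ts)))"

primrec subst :: "(nat \<Rightarrow> trm) \<Rightarrow> trm \<Rightarrow> trm" where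
  "subst \<sigma> (Var x) = \<sigma> x"
| "subst \<sigma> (Fun f ts) = Fun f (map (subst \<sigma>) ts)"

text \<open>\<open>terms \<Sigma> X\<close> is the set of (correctly ranked) terms \<open>T\<^sub>\<Sigma>(X)\<close>.\<close>

inductive_set terms :: "symb set \<Rightarrow> nat set \<Rightarrow> trm set" for \<Sigma> :: "symb set" and X :: "nat set" where
  Var: "x \<in> X \<Longrightarrow> Var x \<in> terms \<Sigma> X"
| Fun: "f \<in> \<Sigma> \<Longrightarrow> length ts = rank f \<Longrightarrow> (\<And>t. t \<in> set ts \<Longrightarrow> t \<in> terms \<Sigma> X)
        \<Longrightarrow> Fun f ts \<in> terms \<Sigma> X"

abbreviation ground_terms :: "symb set \<Rightarrow> trm set" where
  "ground_terms \<Sigma> \<equiv> terms \<Sigma> {}"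


section \<open>Term rewrite systems\<close>

type_synonym rule = "trm \<times> trm"

definition trs :: "rule set \<Rightarrow> bool" where
  "trs R \<longleftrightarrow> finite R \<and>
     (\<forall>(l, r) \<in> R. l \<in> terms UNIV UNIV \<and> r \<in> terms UNIV UNIV \<and> vars r \<subseteq> vars l)"

definition sign :: "rule set \<Rightarrow> symb set" where
  "sign R = (\<Union>(l, r) \<in> R. symbols l \<union> symbols r)"

inductive rstep :: "rule set \<Rightarrow> trm \<Rightarrow> trm \<Rightarrow> bool" for R :: "rule set" where
  root: "(l, r) \<in> R \<Longrightarrow> rstep R (subst \<sigma> l) (subst \<sigma> r)"
| arg: "rstep R s t \<Longrightarrow> rstep R (Fun f (us @ s # vs)) (Fun f (us @ t # vs))"

text \<open>
  Rewrite sequences range over all correctly ranked terms, with variables, over any alphabet.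
\<close>

definition terminating :: "rule set \<Rightarrow> bool" where
  "terminating R \<longleftrightarrow>
     \<not> (\<exists>t :: nat \<Rightarrow> trm. (\<forall>i. t i \<in> terms UNIV UNIV) \<and> (\<forall>i. rstep R (t i) (t (Suc i))))"

definition descendants :: "rule set \<Rightarrow> trm set \<Rightarrow> trm set" where
  "descendants R L = {p. \<exists>q \<in> L. (rstep R)\<^sup>*\<^sup>* q p}"


section \<open>Bottom-up tree automata\<close>

text \<open>
  States are constants outside the input alphabet, and the transition rules are rewrite rules
  over the input symbols and the states.
\<close>

record bta =
  alphabet :: "symb set"
  states :: "symb set"
  finals :: "symb set"
  rules :: "rule set"

abbreviation const :: "symb \<Rightarrow> trm" where
  "const a \<equiv> Fun a []"

definition wf_bta :: "bta \<Rightarrow> bool" where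
  "wf_bta C \<longleftrightarrow>
     finite (alphabet C) \<and> finite (states C) \<and> finite (rules C) \<and>
     (\<forall>a \<in> states C. rank a = 0) \<and> states C \<inter> alphabet C = {} \<and> finals C \<subseteq> states C \<and>
     (\<forall>\<rho> \<in> rules C.
        (\<exists>\<delta> as a. \<delta> \<in> alphabet C \<and> length as = rank \<delta> \<and> set as \<subseteq> states C \<and> a \<in> states C \<and>
           \<rho> = (Fun \<delta> (map const as), const a)) \<or>
        (\<exists>a a'. a \<in> states C \<and> a' \<in> states C \<and> \<rho> = (const a, const a')))"

definition lang :: "bta \<Rightarrow> trm set" where
  "lang C = {t \<in> ground_terms (alphabet C). \<exists>a \<in> finals C. (rstep (rules C))\<^sup>*\<^sup>* t (const a)}"


section \<open>Partial recursive functions\<close>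

datatype recf =
    Zero
  | Succ
  | Proj nat
  | Comp recf "recf list"
  | Prec recf recf
  | Mu recf

text \<open>\<open>computes e xs y\<close>: the partial function denoted by \<open>e\<close> is defined on \<open>xs\<close>, with value \<open>y\<close>.\<close>

inductive computes :: "recf \<Rightarrow> nat list \<Rightarrow> nat \<Rightarrow> bool" where
  Zero: "computes Zero xs 0"
| Succ: "computes Succ [x] (Suc x)"
| Proj: "i < length xs \<Longrightarrow> computes (Proj i) xs (xs ! i)"
| Comp: "list_all2 (\<lambda>g y. computes g xs y) gs ys \<Longrightarrow> computes f ys z
         \<Longrightarrow> computes (Comp f gs) xs z"
| Prec_0: "computes f xs y \<Longrightarrow> computes (Prec f g) (0 # xs) y"
| Prec_Suc: "computes (Prec f g) (n # xs) y \<Longrightarrow> computes g (n # y # xs) z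
         \<Longrightarrow> computes (Prec f g) (Suc n # xs) z"
| Mu: "computes f (n # xs) 0 \<Longrightarrow> (\<And>m. m < n \<Longrightarrow> \<exists>y. computes f (m # xs) (Suc y))
         \<Longrightarrow> computes (Mu f) xs n"

lemma computes_deterministic:
  "computes e xs y \<Longrightarrow> computes e xs y' \<Longrightarrow> y = y'"
proof (induction arbitrary: y' rule: computes.induct)
  case (Zero xs)
  then show ?case by (cases rule: computes.cases) auto
next
  case (Succ x)
  then show ?case by (cases rule: computes.cases) auto
next
  case (Proj i xs)
  from Proj.prems show ?case by (cases rule: computes.cases) auto
next
  case (Comp xs gs ys f z)
  from Comp.prems obtain ys' where ys': "list_all2 (\<lambda>g y. computes g xs y) gs ys'" "computes f ys' y'"
    by (cases rule: computes.cases) auto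
  from Comp.IH(1) ys'(1) have "ys = ys'"
    unfolding list_all2_conv_all_nth by (intro nth_equalityI) auto
  then show ?case using Comp.IH(2) ys'(2) by simp
next
  case (Prec_0 f xs y g)
  from Prec_0.prems have "computes f xs y'" by (cases rule: computes.cases) auto
  then show ?case by (rule Prec_0.IH)
next
  case (Prec_Suc f g n xs y z)
  from Prec_Suc.prems obtain y0 where
    *: "computes (Prec f g) (n # xs) y0" "computes g (n # y0 # xs) y'"
    by (cases rule: computes.cases) auto
  from Prec_Suc.IH(1)[OF *(1)] have "y = y0" .
  with *(2) show ?case by (intro Prec_Suc.IH(2)) simp
next
  case (Mu f n xs)
  from Mu.prems have *: "computes f (y' # xs) 0 \<and> (\<forall>m<y'. \<exists>y. computes f (m # xs) (Suc y))"
    by (cases rule: computes.cases) auto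
  show ?case
  proof (cases n y' rule: linorder_cases)
    case less
    with * obtain y where "computes f (n # xs) (Suc y)" by blast
    from Mu.IH(1)[OF this] show ?thesis by simp
  next
    case greater
    from Mu.IH(2)[OF this] obtain y where "\<And>v. computes f (y' # xs) v \<Longrightarrow> Suc y = v" by blast
    with * show ?thesis by fastforce
  qed
qed


section \<open>Codes of finite objects\<close>

primrec trm_code :: "trm \<Rightarrow> nat" where
  "trm_code (Var x) = sum_encode (Inl x)"
| "trm_code (Fun f ts) =
     sum_encode (Inr (prod_encode (prod_encode f, list_encode (map trm_code ts))))"

definition rule_code :: "rule \<Rightarrow> nat" where
  "rule_code = (\<lambda>(l, r). prod_encode (trm_code l, trm_code r))"

text \<open>Via \<^const>\<open>set_encode\<close>, every finite set has exactly one code.\<close>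

definition symbs_code :: "symb set \<Rightarrow> nat" where
  "symbs_code A = set_encode (prod_encode ` A)"

definition trms_code :: "trm set \<Rightarrow> nat" where
  "trms_code L = set_encode (trm_code ` L)"

definition rules_code :: "rule set \<Rightarrow> nat" where
  "rules_code R = set_encode (rule_code ` R)"

definition bta_code :: "bta \<Rightarrow> nat" where
  "bta_code C =
     list_encode [symbs_code (alphabet C), symbs_code (states C), symbs_code (finals C),
                  rules_code (rules C)]"

lemma inj_trm_code: "inj trm_code"
proof (rule injI)
  fix s t show "trm_code s = trm_code t \<Longrightarrow> s = t"
  proof (induction s arbitrary: t)
    case (Var x) then show ?case by (cases t) (auto simp: sum_encode_eq)
  next
    case (Fun f ts)
    then obtain us where "t = Fun f us" "map trm_code ts = map trm_code us"
      by (cases t) (auto simp: sum_encode_eq prod_encode_eq list_encode_eq)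
    with Fun.IH show ?case by (auto simp: list_eq_iff_nth_eq map_equality_iff)
  qed
qed


section \<open>EPRF term rewrite systems\<close>

text \<open>
  "One can effectively construct": a single partial recursive function, depending only on \<open>R\<close>,
  maps codes of the given \<open>\<Sigma>\<close> and \<open>L\<close> to the code of a suitable automaton.
\<close>

definition EPRF :: "rule set \<Rightarrow> bool" where
  "EPRF R \<longleftrightarrow> trs R \<and>
     (\<exists>e. \<forall>\<Sigma> L. finite \<Sigma> \<and> sign R \<subseteq> \<Sigma> \<and> finite L \<and> L \<subseteq> ground_terms \<Sigma> \<longrightarrow>
        (\<exists>C. wf_bta C \<and> alphabet C = \<Sigma> \<and> lang C = descendants R L \<and>
             computes e [symbs_code \<Sigma>, trms_code L] (bta_code C)))"

end

theory Submission
  imports Defs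
begin

text \<open>
  Rewriting is finitely branching, and the list of one-step successors of a term is computable.
  Termination bounds the length of the rewrite sequences from the finitely many terms of \<open>L\<close>, so
  the set of terms reached in exactly \<open>n\<close> steps is empty for some \<open>n\<close>, which an unbounded search
  finds; hence \<open>D = R\<^sup>*\<^sub>\<Sigma>(L)\<close> is finite and computable.  A bottom-up automaton for \<open>D\<close> evaluates
  every ground term of sufficiently small code to the state that names it.
\<close>

section \<open>Computable functions on encodable types\<close>

text \<open>\<open>EPRF\<close> asks for an actual \<open>recf\<close> program on codes, so most of
  the effort goes into showing that ordinary functions on lists and terms have programs. Only codes
  matter for this: a decoder that undoes an encoding is computed by the identity, and a recursion
  over terms becomes a recursion over numbers, because arguments have smaller codes than the term
  and every number is the code of a term. The program may depend on \<open>R\<close>, so rules are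
  never inspected at run time: matching and instantiation are built into it by induction on
  \<open>R\<close> and on the sides of its rules. No bound on derivation lengths is calculated in
  advance; termination only guarantees that the search halts, and \<open>Mu\<close> needs no more
  than that.\<close>

class encodable =
  fixes enc :: "'a \<Rightarrow> nat"
  assumes inj_enc: "inj enc"

lemma enc_eq_iff [simp]: "enc x = enc y \<longleftrightarrow> x = y"
  using inj_enc by (auto dest: injD)

instantiation nat :: encodable
begin
definition enc_nat :: "nat \<Rightarrow> nat" where [simp]: "enc_nat n = n"
instance by standard (rule injI, simp)
end

instantiation bool :: encodable
begin
definition enc_bool :: "bool \<Rightarrow> nat" where [simp]: "enc_bool b = of_bool b"
instance by standard (auto intro!: injI simp: of_bool_def split: if_splits)
end

instantiation prod :: (encodable, encodable) encodable
begin
definition enc_prod :: "'a \<times> 'b \<Rightarrow> nat" where "enc_prod p = prod_encode (enc (fst p), enc (snd p))"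
instance by standard (auto simp: enc_prod_def prod_eq_iff intro: injI)
end

instantiation list :: (encodable) encodable
begin
definition enc_list :: "'a list \<Rightarrow> nat" where "enc_list xs = list_encode (map enc xs)"
instance
  by standard (rule injI, simp add: enc_list_def list_encode_eq inj_map_eq_map[OF inj_enc])
end

instantiation trm :: encodable
begin
definition enc_trm :: "trm \<Rightarrow> nat" where "enc_trm = trm_code"
instance by standard (simp add: enc_trm_def inj_trm_code)
end

lemma enc_pair [simp]: "enc (a, b) = prod_encode (enc a, enc b)"
  by (simp add: enc_prod_def)

lemma enc_Nil [simp]: "enc [] = 0"
  by (simp add: enc_list_def)

lemma enc_Cons [simp]: "enc (x # xs) = Suc (prod_encode (enc x, enc xs))"
  by (simp add: enc_list_def)

lemma enc_eq_0_iff_Nil [simp]: "enc xs = 0 \<longleftrightarrow> xs = []"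
  by (cases xs) auto

lemma enc_symb: "enc (f :: symb) = prod_encode f"
  by (cases f) simp

text \<open>\<open>sum_encode\<close> puts function terms on the odd numbers and variables on the
  even ones, so parity tells them apart, and halving and unpairing recover symbol and
  arguments.\<close>

lemma enc_Fun: "enc (Fun f ts) = Suc (2 * prod_encode (enc f, enc ts))"
  by (simp add: enc_trm_def enc_list_def enc_symb sum_encode_def)

lemma enc_rule: "enc (\<rho> :: rule) = rule_code \<rho>"
  by (cases \<rho>) (simp add: rule_code_def enc_trm_def)

subsection \<open>Arithmetic and pairing\<close>

lemma computes_Comp1: "computes g xs y \<Longrightarrow> computes f [y] z \<Longrightarrow> computes (Comp f [g]) xs z"
  by (rule computes.Comp[of _ _ "[y]"]) auto

lemma computes_Comp2:
  "computes g xs y \<Longrightarrow> computes h xs y' \<Longrightarrow> computes f [y, y'] z \<Longrightarrow> computes (Comp f [g, h]) xs z"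
  by (rule computes.Comp[of _ _ "[y, y']"]) auto

lemma computes_Proj_0: "computes (Proj 0) (x # xs) x"
  using computes.Proj[of 0 "x # xs"] by simp

lemma computes_Proj_1: "computes (Proj (Suc 0)) (x # y # xs) y"
  using computes.Proj[of "Suc 0" "x # y # xs"] by simp

lemma computes_Proj_2: "computes (Proj (Suc (Suc 0))) (x # y # z # xs) z"
  using computes.Proj[of "Suc (Suc 0)" "x # y # z # xs"] by simp

lemmas computes_intros =
  computes_Comp1 computes_Comp2 computes_Proj_0 computes_Proj_1 computes_Proj_2 computes.Succ

lemma computes_const: "\<exists>e. \<forall>xs. computes e xs n"
proof (induction n)
  case 0
  show ?case using computes.Zero by blast
next
  case (Suc n)
  then obtain e where "\<forall>xs. computes e xs n" by blast
  then have "\<forall>xs. computes (Comp Succ [e]) xs (Suc n)" by (auto intro: computes_intros)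
  then show ?case by blast
qed

definition rec_add :: recf where
  "rec_add = Prec (Proj 0) (Comp Succ [Proj (Suc 0)])"

lemma computes_add: "computes rec_add [m, n] (m + n)"
proof (induction m)
  case 0
  show ?case by (auto simp: rec_add_def intro!: computes.Prec_0 computes_intros)
next
  case (Suc m)
  have "computes (Comp Succ [Proj (Suc 0)]) [m, m + n, n] (Suc (m + n))"
    by (rule computes_intros)+
  with Suc show ?case unfolding rec_add_def by (auto intro: computes.Prec_Suc)
qed

definition rec_triangle :: recf where
  "rec_triangle = Prec Zero (Comp rec_add [Proj (Suc 0), Comp Succ [Proj 0]])"

lemma computes_triangle: "computes rec_triangle [n] (triangle n)"
proof (induction n)
  case 0
  show ?case by (auto simp: rec_triangle_def intro!: computes.Prec_0 computes.Zero)
next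
  case (Suc n)
  have "computes (Comp rec_add [Proj (Suc 0), Comp Succ [Proj 0]]) [n, triangle n] (triangle n + Suc n)"
    by (rule computes_intros computes_add)+
  with Suc show ?case unfolding rec_triangle_def by (auto intro: computes.Prec_Suc)
qed

definition rec_pair :: recf where
  "rec_pair = Comp rec_add [Comp rec_triangle [rec_add], Proj 0]"

lemma computes_pair: "computes rec_pair [m, n] (prod_encode (m, n))"
proof -
  have "computes rec_pair [m, n] (triangle (m + n) + m)"
    unfolding rec_pair_def by (rule computes_intros computes_add computes_triangle)+
  then show ?thesis by (simp add: prod_encode_def)
qed

definition rec_pred :: recf where
  "rec_pred = Prec Zero (Proj 0)"

lemma computes_pred: "computes rec_pred [n] (n - 1)"
proof (induction n)
  case 0
  show ?case by (auto simp: rec_pred_def intro!: computes.Prec_0 computes.Zero)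
next
  case (Suc n)
  have "computes (Proj 0) [n, n - 1] n" by (rule computes_intros)
  with Suc show ?case unfolding rec_pred_def by (auto intro: computes.Prec_Suc)
qed

text \<open>\<open>Prec\<close> recurses on its first argument, here the number of decrements, so
  the subtrahend stands first.\<close>

definition rec_diff :: recf where
  "rec_diff = Prec (Proj 0) (Comp rec_pred [Proj (Suc 0)])"

lemma computes_diff: "computes rec_diff [m, n] (n - m)"
proof (induction m)
  case 0
  show ?case by (auto simp: rec_diff_def intro!: computes.Prec_0 computes_intros)
next
  case (Suc m)
  have "computes (Comp rec_pred [Proj (Suc 0)]) [m, n - m, n] (n - m - 1)"
    by (rule computes_intros computes_pred)+
  with Suc show ?case unfolding rec_diff_def by (auto intro: computes.Prec_Suc)
qed

text \<open>The diagonal \<open>m + n\<close> of \<open>prod_encode (m, n)\<close>, from which both projections are read off,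
  is its triangular root.\<close>

definition rec_diagonal :: recf where
  "rec_diagonal = Mu (Comp rec_diff [Comp rec_triangle [Comp Succ [Proj 0]], Comp Succ [Proj (Suc 0)]])"

lemma triangle_mono: "m \<le> n \<Longrightarrow> triangle m \<le> triangle n"
  by (induction n) (auto simp: le_Suc_eq)

lemma computes_diagonal: "computes rec_diagonal [prod_encode (m, n)] (m + n)"
proof -
  let ?z = "prod_encode (m, n)"
  let ?e = "Comp rec_diff [Comp rec_triangle [Comp Succ [Proj 0]], Comp Succ [Proj (Suc 0)]]"
  have *: "computes ?e [s, ?z] (Suc ?z - triangle (Suc s))" for s
    by (rule computes_intros computes_diff computes_triangle)+
  \<comment> \<open>\<open>prod_encode (m, n)\<close> is \<open>triangle (m + n) + m\<close>, and
    passing to \<open>triangle (Suc (m + n))\<close> adds \<open>m + n + 1\<close>, which is more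
    than \<open>m\<close>. The \<open>Suc\<close> in front of \<open>?z\<close> makes the truncated
    difference test a strict inequality.\<close>
  have "Suc ?z - triangle (Suc (m + n)) = 0"
    by (simp add: prod_encode_def)
  with *[of "m + n"] have 0: "computes ?e [m + n, ?z] 0" by metis
  have "\<exists>y. computes ?e [s, ?z] (Suc y)" if "s < m + n" for s
  proof -
    have "triangle (Suc s) \<le> triangle (m + n)" using that by (intro triangle_mono) simp
    then have "triangle (Suc s) \<le> ?z" unfolding prod_encode_def by simp
    then have "Suc ?z - triangle (Suc s) = Suc (?z - triangle (Suc s))" by (rule Suc_diff_le)
    with *[of s] show ?thesis by metis
  qed
  with 0 show ?thesis unfolding rec_diagonal_def by (intro computes.Mu)
qed

definition rec_fst :: recf where
  "rec_fst = Comp rec_diff [Comp rec_triangle [rec_diagonal], Proj 0]"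

lemma computes_fst: "computes rec_fst [prod_encode (m, n)] m"
proof -
  have "computes rec_fst [prod_encode (m, n)] (prod_encode (m, n) - triangle (m + n))"
    unfolding rec_fst_def by (rule computes_intros computes_diff computes_triangle computes_diagonal)+
  then show ?thesis by (simp add: prod_encode_def)
qed

definition rec_snd :: recf where
  "rec_snd = Comp rec_diff [rec_fst, rec_diagonal]"

lemma computes_snd: "computes rec_snd [prod_encode (m, n)] n"
proof -
  have "computes rec_snd [prod_encode (m, n)] (m + n - m)"
    unfolding rec_snd_def by (rule computes_intros computes_diff computes_fst computes_diagonal)+
  then show ?thesis by simp
qed

subsection \<open>Closure properties\<close>

named_theorems computable_intros

text \<open>Unary and total by design: several arguments travel as one nested pair, so the closure
  rules need no bookkeeping of argument lists, and none has a definedness condition.\<close>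

definition computable :: "('a::encodable \<Rightarrow> 'b::encodable) \<Rightarrow> bool" where
  "computable f \<longleftrightarrow> (\<exists>e. \<forall>x. computes e [enc x] (enc (f x)))"

lemma computableI:
  assumes "\<And>x. computes e [enc x] (enc (f x))"
  shows "computable f"
  using assms unfolding computable_def by blast

lemma computableE:
  assumes "computable f"
  obtains e where "\<And>x. computes e [enc x] (enc (f x))"
  using assms unfolding computable_def by blast

lemma computable_id [computable_intros]: "computable (\<lambda>x. x)"
  by (rule computableI) (rule computes_Proj_0)

lemma computable_const [computable_intros]: "computable (\<lambda>x. c)"
  using computes_const[of "enc c"] by (auto intro: computableI)

lemma computable_compose:
  assumes "computable f" "computable g"
  shows "computable (\<lambda>x. f (g x))"
proof -
  obtain e where "\<And>x. computes e [enc x] (enc (f x))"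
    using computableE[OF assms(1)] by blast
  moreover obtain d where "\<And>x. computes d [enc x] (enc (g x))"
    using computableE[OF assms(2)] by blast
  ultimately show ?thesis by (intro computableI) (rule computes_Comp1)
qed

lemma computable_Pair [computable_intros]:
  assumes "computable f" "computable g"
  shows "computable (\<lambda>x. (f x, g x))"
proof -
  obtain e where "\<And>x. computes e [enc x] (enc (f x))"
    using computableE[OF assms(1)] by blast
  moreover obtain d where "\<And>x. computes d [enc x] (enc (g x))"
    using computableE[OF assms(2)] by blast
  ultimately show ?thesis by (intro computableI) (simp, rule computes_Comp2[OF _ _ computes_pair])
qed

lemma computable_fst [computable_intros]:
  assumes "computable f"
  shows "computable (\<lambda>x. fst (f x))"
proof -
  obtain e where "\<And>x. computes e [enc x] (enc (f x))"
    using computableE[OF assms] by blast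
  then show ?thesis
    unfolding enc_prod_def by (intro computableI) (rule computes_Comp1[OF _ computes_fst])
qed

lemma computable_snd [computable_intros]:
  assumes "computable f"
  shows "computable (\<lambda>x. snd (f x))"
proof -
  obtain e where "\<And>x. computes e [enc x] (enc (f x))"
    using computableE[OF assms] by blast
  then show ?thesis
    unfolding enc_prod_def by (intro computableI) (rule computes_Comp1[OF _ computes_snd])
qed

text \<open>Computability depends only on the codes, so functions with different result types may be
  exchanged.\<close>

lemma computable_recode:
  fixes f :: "'a::encodable \<Rightarrow> 'b::encodable" and g :: "'a \<Rightarrow> 'c::encodable"
  assumes "computable g" "\<And>x. enc (f x) = enc (g x)"
  shows "computable f"
  using assms unfolding computable_def by simp

lemma computable_Suc [computable_intros]:
  assumes "computable f"
  shows "computable (\<lambda>x. Suc (f x))"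
proof -
  obtain e where "\<And>x. computes e [enc x] (enc (f x))"
    using computableE[OF assms] by blast
  then show ?thesis
    unfolding enc_nat_def by (intro computableI) (simp, rule computes_Comp1[OF _ computes.Succ])
qed

text \<open>Every later loop except the unbounded search reduces to this iteration, with whatever it
  must remember kept in the iterated value.\<close>

lemma computable_funpow:
  fixes f :: "'a::encodable \<Rightarrow> 'b::encodable \<Rightarrow> 'b"
  assumes f: "computable (\<lambda>p. f (fst p) (snd p))" and n: "computable n" and a: "computable a"
  shows "computable (\<lambda>x. (f x ^^ n x) (a x))"
proof -
  obtain ef where ef: "computes ef [enc p] (enc (f (fst p) (snd p)))" for p
    using computableE[OF f] by blast
  obtain en where en: "computes en [enc x] (n x)" for x
    using computableE[OF n] unfolding enc_nat_def by blast
  obtain ea where ea: "computes ea [enc x] (enc (a x))" for x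
    using computableE[OF a] by blast
  \<comment> \<open>The step receives counter, last value and parameter; the counter is ignored and
    the other two are paired, parameter first.\<close>
  let ?step = "Comp ef [Comp rec_pair [Proj (Suc (Suc 0)), Proj (Suc 0)]]"
  have "computes (Prec ea ?step) [k, enc x] (enc ((f x ^^ k) (a x)))" for k x
  proof (induction k)
    case 0
    show ?case by (simp add: computes.Prec_0 ea)
  next
    case (Suc k)
    have "computes ?step [k, enc ((f x ^^ k) (a x)), enc x] (enc (f x ((f x ^^ k) (a x))))"
      using ef[of "(x, (f x ^^ k) (a x))"] by (auto intro: computes_intros computes_pair)
    with Suc show ?case by (auto intro: computes.Prec_Suc)
  qed
  then show ?thesis by (intro computableI) (rule computes_Comp2[OF en computes_Proj_0])
qed

text \<open>A Boolean has code 0 or 1, so the conditional is the constant function with value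
  \<open>f x\<close>, iterated that often from \<open>g x\<close>.\<close>

lemma computable_If [computable_intros]:
  assumes "computable b" "computable f" "computable g"
  shows "computable (\<lambda>x. if b x then f x else g x)"
proof -
  have n: "computable (\<lambda>x. enc (b x))"
    using assms(1) by (rule computable_recode) simp
  have "computable (\<lambda>x. ((\<lambda>_. f x) ^^ enc (b x)) (g x))"
    by (intro computable_funpow n assms computable_compose[OF assms(2)] computable_fst computable_id)
  moreover have "((\<lambda>_. f x) ^^ enc (b x)) (g x) = (if b x then f x else g x)" for x by simp
  ultimately show ?thesis by simp
qed

text \<open>Not a statement about \<^const>\<open>computable\<close>, since the search may fail on some arguments.\<close>

lemma computes_search:
  fixes f :: "'a::encodable \<Rightarrow> nat \<Rightarrow> nat" and h :: "'a \<Rightarrow> nat \<Rightarrow> 'b::encodable"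
  assumes f: "computable (\<lambda>p. f (fst p) (snd p))" and h: "computable (\<lambda>p. h (fst p) (snd p))"
  shows "\<exists>e. \<forall>x. (\<exists>n. f x n = 0) \<longrightarrow> computes e [enc x] (enc (h x (LEAST n. f x n = 0)))"
proof -
  obtain ef where ef: "computes ef [enc p] (f (fst p) (snd p))" for p
    using computableE[OF f] unfolding enc_nat_def by blast
  obtain eh where eh: "computes eh [enc p] (enc (h (fst p) (snd p)))" for p
    using computableE[OF h] by blast
  let ?e = "Comp ef [Comp rec_pair [Proj (Suc 0), Proj 0]]"
  have e: "computes ?e [n, enc x] (f x n)" for n x
    using ef[of "(x, n)"] by (auto intro: computes_intros computes_pair)
  have "computes (Comp eh [Comp rec_pair [Proj 0, Mu ?e]]) [enc x] (enc (h x (LEAST n. f x n = 0)))"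
    if ex: "\<exists>n. f x n = 0" for x
  proof -
    let ?n = "LEAST n. f x n = 0"
    have "computes (Mu ?e) [enc x] ?n"
    proof (rule computes.Mu)
      show "computes ?e [?n, enc x] 0" using e[of ?n x] LeastI_ex[OF ex] by simp
      show "\<exists>y. computes ?e [m, enc x] (Suc y)" if "m < ?n" for m
        using e[of m x] not_less_Least[OF that] by (metis not0_implies_Suc)
    qed
    then show ?thesis
      using eh[of "(x, ?n)"] by (auto intro!: computes_intros computes_pair)
  qed
  then show ?thesis by blast
qed

lemma computable_compose2:
  assumes "computable (\<lambda>p. f (fst p) (snd p))" "computable g" "computable h"
  shows "computable (\<lambda>x. f (g x) (h x))"
  using computable_compose[OF assms(1) computable_Pair[OF assms(2,3)]] by simp

section \<open>Arithmetic, Boolean and bit operations\<close>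

lemma computable_enc [computable_intros]:
  assumes "computable f"
  shows "computable (\<lambda>x. enc (f x))"
  using assms by (rule computable_recode) simp

lemma computable_add [computable_intros]:
  assumes "computable f" "computable g"
  shows "computable (\<lambda>x. f x + g x :: nat)"
proof -
  have "computable (\<lambda>p. fst p + snd p :: nat)"
    using computes_Comp2[OF computes_fst computes_snd computes_add]
    by (intro computableI) (auto simp: enc_prod_def)
  then show ?thesis using assms by (rule computable_compose2)
qed

lemma computable_diff [computable_intros]:
  assumes "computable f" "computable g"
  shows "computable (\<lambda>x. f x - g x :: nat)"
proof -
  have "computable (\<lambda>p. fst p - snd p :: nat)"
    using computes_Comp2[OF computes_snd computes_fst computes_diff]
    by (intro computableI) (auto simp: enc_prod_def)
  then show ?thesis using assms by (rule computable_compose2)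
qed

lemma computable_Not [computable_intros]:
  assumes "computable b"
  shows "computable (\<lambda>x. \<not> b x)"
proof -
  have "computable (\<lambda>x. if b x then False else True)"
    by (intro computable_intros assms)
  moreover have "(\<lambda>x. if b x then False else True) = (\<lambda>x. \<not> b x)" by auto
  ultimately show ?thesis by simp
qed

lemma computable_conj [computable_intros]:
  assumes "computable b" "computable c"
  shows "computable (\<lambda>x. b x \<and> c x)"
proof -
  have "computable (\<lambda>x. if b x then c x else False)"
    by (intro computable_intros assms)
  moreover have "(\<lambda>x. if b x then c x else False) = (\<lambda>x. b x \<and> c x)" by auto
  ultimately show ?thesis by simp
qed

text \<open>Since \<open>enc\<close> is injective, equality can be tested on codes: the sum of the
  two truncated differences is zero only for equal numbers, and iterating a constant
  \<open>False\<close> from \<open>True\<close> detects zero.\<close>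

lemma computable_eq [computable_intros]:
  fixes f g :: "'a::encodable \<Rightarrow> 'b::encodable"
  assumes "computable f" "computable g"
  shows "computable (\<lambda>x. f x = g x)"
proof -
  have "computable (\<lambda>x. ((\<lambda>_. False) ^^ ((enc (f x) - enc (g x)) + (enc (g x) - enc (f x)))) True)"
    by (intro computable_funpow computable_intros assms)
  moreover have "((\<lambda>_. False) ^^ n) True \<longleftrightarrow> n = 0" for n by (cases n) auto
  ultimately show ?thesis by (simp add: eq_iff[of "enc _", symmetric])
qed

lemma computable_odd [computable_intros]:
  assumes "computable f"
  shows "computable (\<lambda>x. odd (f x :: nat))"
proof -
  have "computable (\<lambda>x. (Not ^^ f x) False)"
    by (intro computable_funpow computable_intros assms)
  moreover have "(Not ^^ n) False \<longleftrightarrow> odd n" for n by (induction n) auto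
  ultimately show ?thesis by simp
qed

lemma computable_div2 [computable_intros]:
  assumes "computable f"
  shows "computable (\<lambda>x. f x div 2 :: nat)"
proof -
  \<comment> \<open>Swapping lets the two components grow in alternate rounds, so each counts half
    of them.\<close>
  let ?step = "\<lambda>p :: nat \<times> nat. (snd p, Suc (fst p))"
  have "computable (\<lambda>x. fst ((?step ^^ f x) (0, 0)))"
    by (intro computable_fst computable_funpow) (intro computable_intros assms)+
  moreover have "(?step ^^ n) (0, 0) = (n div 2, Suc n div 2)" for n
    by (induction n) auto
  ultimately show ?thesis by simp
qed

lemma computable_power2 [computable_intros]:
  assumes "computable f"
  shows "computable (\<lambda>x. 2 ^ f x :: nat)"
proof -
  have "computable (\<lambda>x. ((\<lambda>a. a + a) ^^ f x) (1 :: nat))"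
    by (intro computable_funpow computable_intros assms)
  moreover have "((\<lambda>a. a + a) ^^ n) (1 :: nat) = 2 ^ n" for n by (induction n) auto
  ultimately show ?thesis by simp
qed

lemma computable_set_decode [computable_intros]:
  assumes "computable f" "computable g"
  shows "computable (\<lambda>x. f x \<in> set_decode (g x))"
proof -
  have "computable (\<lambda>x. odd (((\<lambda>a. a div 2) ^^ f x) (g x)))"
    by (intro computable_odd computable_funpow computable_intros assms)
  moreover have "((\<lambda>a. a div 2) ^^ n) m = m div 2 ^ n" for m n :: nat
    by (induction n) (auto simp: div_mult2_eq[symmetric] mult.commute)
  ultimately show ?thesis by (simp add: set_decode_def)
qed

text \<open>A number and the pair that it decodes to have the same code, so the program for
  \<open>f\<close> already serves.\<close>

lemma computable_prod_decode [computable_intros]: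
  assumes "computable f"
  shows "computable (\<lambda>x. prod_decode (f x))"
  using assms by (rule computable_recode) (simp add: enc_symb)

subsection \<open>Lists\<close>

lemma computable_Cons [computable_intros]:
  assumes "computable f" "computable g"
  shows "computable (\<lambda>x. f x # g x)"
proof -
  have "computable (\<lambda>x. Suc (enc (f x, g x)))"
    by (intro computable_intros assms)
  then show ?thesis by (rule computable_recode) simp
qed

lemma computable_hd [computable_intros]:
  fixes f :: "'a::encodable \<Rightarrow> 'b::encodable list"
  assumes "computable f"
  shows "computable (\<lambda>x. hd (f x))"
proof -
  \<comment> \<open>\<open>hd []\<close> is unspecified but is one fixed element, so its code can be
    a constant of the program.\<close>
  have "computable (\<lambda>x. if f x = [] then enc (hd [] :: 'b) else fst (prod_decode (enc (f x) - 1)))"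
    by (intro computable_intros assms)
  then show ?thesis
  proof (rule computable_recode)
    show "enc (hd (f x)) = enc (if f x = [] then enc (hd [] :: 'b) else fst (prod_decode (enc (f x) - 1)))" for x
      by (cases "f x") auto
  qed
qed

lemma computable_tl [computable_intros]:
  assumes "computable f"
  shows "computable (\<lambda>x. tl (f x))"
proof -
  have "computable (\<lambda>x. if f x = [] then 0 else snd (prod_decode (enc (f x) - 1)))"
    by (intro computable_intros assms)
  then show ?thesis
  proof (rule computable_recode)
    show "enc (tl (f x)) = enc (if f x = [] then 0 else snd (prod_decode (enc (f x) - 1)))" for x
      by (cases "f x") auto
  qed
qed

section \<open>Recursion over lists\<close>

lemma length_le_enc: "length xs \<le> enc xs"
proof (induction xs)
  case (Cons x xs)
  then show ?case using le_prod_encode_2[of "enc xs" "enc x"] by simp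
qed simp

text \<open>The code of a list bounds its length, so iterating that often surely exhausts it; the
  surplus rounds find the empty list and change nothing.\<close>

lemma computable_fold:
  fixes f :: "'a::encodable \<Rightarrow> 'b::encodable \<Rightarrow> 'c::encodable \<Rightarrow> 'c"
  assumes f: "computable (\<lambda>p. f (fst p) (fst (snd p)) (snd (snd p)))"
    and xs: "computable xs" and a: "computable a"
  shows "computable (\<lambda>x. fold (f x) (xs x) (a x))"
proof -
  define step where
    "step x p = (if fst p = [] then p else (tl (fst p), f x (hd (fst p)) (snd p)))" for x p
  have "computable (\<lambda>p. f (fst p) (hd (fst (snd p))) (snd (snd p)))"
    using computable_compose[OF f, of "\<lambda>p. (fst p, hd (fst (snd p)), snd (snd p))"]
    by (simp add: computable_intros)
  note f' = this
  have "computable (\<lambda>x. snd ((step x ^^ enc (xs x)) (xs x, a x)))"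
    unfolding step_def by (intro computable_snd computable_funpow) (intro computable_intros xs a f')+
  moreover have "(step x ^^ n) (ys, b) = ([], fold (f x) ys b)" if "length ys \<le> n" for x n ys b
    using that
  proof (induction n arbitrary: ys b)
    case (Suc n)
    then show ?case
      by (cases ys) (auto simp: step_def funpow_Suc_right simp del: funpow.simps(2))
  qed simp
  ultimately show ?thesis by (simp add: length_le_enc)
qed

text \<open>\<open>rec_list\<close> works from the right and shows its step function the remaining
  tail. Folding over the reversed list gives the order, and the accumulator rebuilds the tail
  alongside the result.\<close>

lemma computable_rec_list:
  fixes h :: "'a::encodable \<Rightarrow> 'b::encodable \<Rightarrow> 'b list \<Rightarrow> 'c::encodable \<Rightarrow> 'c"
  assumes h: "computable (\<lambda>p. h (fst p) (fst (snd p)) (fst (snd (snd p))) (snd (snd (snd p))))"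
    and a: "computable a" and xs: "computable xs"
  shows "computable (\<lambda>x. rec_list (a x) (h x) (xs x))"
proof -
  have rev: "computable (\<lambda>x. rev (xs x))"
    unfolding rev_conv_fold by (intro computable_fold computable_intros xs)
  let ?step = "\<lambda>x y p. (y # fst p, h x y (fst p) (snd p))"
  have "computable (\<lambda>x. snd (fold (?step x) (rev (xs x)) ([], a x)))"
    by (intro computable_snd computable_fold) (intro computable_intros h rev a)+
  moreover have "fold (?step x) (rev ys) ([], b) = (ys, rec_list b (h x) ys)" for x ys b
    by (induction ys) auto
  ultimately show ?thesis by simp
qed

lemma computable_append [computable_intros]:
  assumes "computable f" "computable g"
  shows "computable (\<lambda>x. f x @ g x)"
proof -
  have "computable (\<lambda>x. rec_list (g x) (\<lambda>y _ r. y # r) (f x))"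
    by (intro computable_rec_list computable_intros assms)
  moreover have "rec_list ys (\<lambda>y _ r. y # r) xs = xs @ ys" for xs ys :: "'b list"
    by (induction xs) auto
  ultimately show ?thesis by simp
qed

lemma computable_map [computable_intros]:
  assumes f: "computable (\<lambda>p. f (fst p) (snd p))" and "computable xs"
  shows "computable (\<lambda>x. map (f x) (xs x))"
proof -
  have "computable (\<lambda>x. rec_list [] (\<lambda>y _ r. f x y # r) (xs x))"
    by (intro computable_rec_list computable_intros assms computable_compose2[OF f])
  moreover have "rec_list [] (\<lambda>y _ r. f x y # r) ys = map (f x) ys" for x ys
    by (induction ys) auto
  ultimately show ?thesis by simp
qed

lemma computable_concat [computable_intros]:
  assumes "computable f"
  shows "computable (\<lambda>x. concat (f x))"
proof -
  have "computable (\<lambda>x. rec_list [] (\<lambda>y _ r. y @ r) (f x))"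
    by (intro computable_rec_list computable_intros assms)
  moreover have "rec_list [] (\<lambda>y _ r. y @ r) xs = concat xs" for xs :: "'b list list"
    by (induction xs) auto
  ultimately show ?thesis by simp
qed

lemma computable_filter [computable_intros]:
  assumes P: "computable (\<lambda>p. P (fst p) (snd p))" and "computable xs"
  shows "computable (\<lambda>x. filter (P x) (xs x))"
proof -
  have "computable (\<lambda>x. rec_list [] (\<lambda>y _ r. if P x y then y # r else r) (xs x))"
    by (intro computable_rec_list computable_intros assms computable_compose2[OF P])
  moreover have "rec_list [] (\<lambda>y _ r. if P x y then y # r else r) ys = filter (P x) ys" for x ys
    by (induction ys) auto
  ultimately show ?thesis by simp
qed

lemma computable_length [computable_intros]:
  assumes "computable f"
  shows "computable (\<lambda>x. length (f x))"
proof -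
  have "computable (\<lambda>x. rec_list 0 (\<lambda>_ _ r. Suc r) (f x))"
    by (intro computable_rec_list computable_intros assms)
  moreover have "rec_list 0 (\<lambda>_ _ r. Suc r) xs = length xs" for xs :: "'b list"
    by (induction xs) auto
  ultimately show ?thesis by simp
qed

lemma computable_drop [computable_intros]:
  assumes "computable f" "computable g"
  shows "computable (\<lambda>x. drop (f x) (g x))"
proof -
  have "computable (\<lambda>x. (tl ^^ f x) (g x))"
    by (intro computable_funpow computable_intros assms)
  moreover have "(tl ^^ n) xs = drop n xs" for n and xs :: "'b list"
    by (induction n) (auto simp: drop_Suc drop_tl)
  ultimately show ?thesis by simp
qed

text \<open>The table of all earlier values is grown by iteration; its length is the argument whose
  value comes next.\<close>

lemma computable_course_of_values:
  fixes F :: "nat \<Rightarrow> 'a::encodable"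
  assumes H: "computable (\<lambda>p. H (fst p) (snd p))" and F: "\<And>n. F n = H n (map F [0..<n])"
  shows "computable F"
proof -
  let ?table = "\<lambda>n. ((\<lambda>T. T @ [H (length T) T]) ^^ n) []"
  have "computable (\<lambda>n. H n (?table n))"
    by (intro computable_compose2[OF H] computable_funpow computable_intros)
  moreover have table: "?table n = map F [0..<n]" for n
    by (induction n) (simp_all add: F[symmetric])
  ultimately show ?thesis by (simp add: F[symmetric])
qed

lemma computable_upt_0 [computable_intros]:
  assumes "computable f"
  shows "computable (\<lambda>x. [0..<f x])"
proof -
  have "computable (\<lambda>x. ((\<lambda>xs. xs @ [length xs]) ^^ f x) [])"
    by (intro computable_funpow computable_intros assms)
  moreover have "((\<lambda>xs. xs @ [length xs]) ^^ n) [] = [0..<n]" for n by (induction n) auto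
  ultimately show ?thesis by simp
qed

lemma computable_set_encode [computable_intros]:
  assumes "computable f"
  shows "computable (\<lambda>x. set_encode (set (f x)))"
proof -
  \<comment> \<open>\<open>set_encode\<close> is a sum of distinct powers of two; the membership
    test keeps repeated list entries from being added twice.\<close>
  let ?add = "\<lambda>n k. if n \<in> set_decode k then k else 2 ^ n + k"
  have "computable (\<lambda>x. rec_list 0 (\<lambda>n _ k. ?add n k) (f x))"
    by (intro computable_rec_list computable_intros assms)
  moreover have "rec_list 0 (\<lambda>n _ k. ?add n k) xs = set_encode (set xs)" for xs
    by (induction xs) (auto simp: insert_absorb)
  ultimately show ?thesis by simp
qed

section \<open>Terms\<close>

fun root_symb :: "trm \<Rightarrow> symb" where
  "root_symb (Var x) = (0, 0)"
| "root_symb (Fun f ts) = f"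

fun args :: "trm \<Rightarrow> trm list" where
  "args (Var x) = []"
| "args (Fun f ts) = ts"

fun is_Fun :: "trm \<Rightarrow> bool" where
  "is_Fun (Var x) \<longleftrightarrow> False"
| "is_Fun (Fun f ts) \<longleftrightarrow> True"

lemma enc_Var: "enc (Var x) = 2 * x"
  by (simp add: enc_trm_def sum_encode_def)

lemma computable_is_Fun [computable_intros]:
  assumes "computable f"
  shows "computable (\<lambda>x. is_Fun (f x))"
proof -
  have "computable (\<lambda>x. odd (enc (f x)))"
    by (intro computable_intros assms)
  moreover have "odd (enc t) \<longleftrightarrow> is_Fun t" for t
    by (cases t) (auto simp: enc_Var enc_Fun)
  ultimately show ?thesis by simp
qed

lemma computable_root_symb [computable_intros]:
  assumes "computable f"
  shows "computable (\<lambda>x. root_symb (f x))"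
proof -
  have "computable (\<lambda>x. if is_Fun (f x) then fst (prod_decode (enc (f x) div 2)) else enc (0 :: nat, 0 :: nat))"
    by (intro computable_intros assms)
  then show ?thesis
  proof (rule computable_recode)
    show "enc (root_symb (f x)) =
      enc (if is_Fun (f x) then fst (prod_decode (enc (f x) div 2)) else enc (0 :: nat, 0 :: nat))" for x
      by (cases "f x") (auto simp: enc_Fun)
  qed
qed

lemma computable_args [computable_intros]:
  assumes "computable f"
  shows "computable (\<lambda>x. args (f x))"
proof -
  have "computable (\<lambda>x. if is_Fun (f x) then snd (prod_decode (enc (f x) div 2)) else 0)"
    by (intro computable_intros assms)
  then show ?thesis
  proof (rule computable_recode)
    show "enc (args (f x)) = enc (if is_Fun (f x) then snd (prod_decode (enc (f x) div 2)) else 0)" for x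
      by (cases "f x") (auto simp: enc_Fun)
  qed
qed

lemma computable_Fun [computable_intros]:
  assumes "computable f" "computable g"
  shows "computable (\<lambda>x. Fun (f x) (g x))"
proof -
  have "computable (\<lambda>x. Suc (enc (f x, g x) + enc (f x, g x)))"
    by (intro computable_intros assms)
  then show ?thesis by (rule computable_recode) (simp add: enc_Fun)
qed

section \<open>Order and surjectivity of term codes\<close>

lemma elem_less_enc: "x \<in> set xs \<Longrightarrow> enc x < enc xs"
proof (induction xs)
  case (Cons y xs)
  then show ?case
    using le_prod_encode_1[of "enc y" "enc xs"] le_prod_encode_2[of "enc xs" "enc y"] by auto
qed simp

text \<open>This licenses course-of-values recursion on term codes, and it makes every set of terms
  with codes below a bound closed under arguments.\<close>

lemma enc_arg_less: "t \<in> set ts \<Longrightarrow> enc t < enc (Fun f ts)"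
  using elem_less_enc[of t ts] le_prod_encode_2[of "enc ts" "enc f"] by (simp add: enc_Fun)

text \<open>Parity picks the constructor; an odd number yields a symbol and a list of smaller
  numbers, to which induction applies. The incorrectly ranked terms in \<open>trm\<close> keep the
  codes free of gaps.\<close>

lemma surj_enc_trm: "\<exists>t :: trm. enc t = n"
proof (induction n rule: less_induct)
  case (less n)
  show ?case
  proof (cases "even n")
    case True
    then show ?thesis by (metis enc_Var evenE)
  next
    case False
    then obtain m where n: "n = Suc (2 * m)" by (metis oddE Suc_eq_plus1)
    obtain a b where m: "m = prod_encode (a, b)" by (metis prod_decode_inverse surj_pair)
    have b: "enc (list_decode b) = b" by (simp add: enc_list_def map_idI)
    have "\<exists>t :: trm. enc t = k" if "k \<in> set (list_decode b)" for k
    proof (rule less)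
      show "k < n"
        using elem_less_enc[OF that] le_prod_encode_2[of b a] by (simp add: n m b)
    qed
    then obtain u :: "nat \<Rightarrow> trm" where u: "\<And>k. k \<in> set (list_decode b) \<Longrightarrow> enc (u k) = k" by metis
    have "map enc (map u (list_decode b)) = list_decode b"
      by (simp add: map_idI u)
    then have "enc (map u (list_decode b)) = b" by (simp add: enc_list_def)
    then have "enc (Fun (prod_decode a) (map u (list_decode b))) = n"
      by (simp add: enc_Fun enc_symb n m)
    then show ?thesis by blast
  qed
qed

definition dec_trm :: "nat \<Rightarrow> trm" where
  "dec_trm n = (SOME t. enc t = n)"

lemma enc_dec_trm [simp]: "enc (dec_trm n) = n"
  unfolding dec_trm_def using surj_enc_trm by (rule someI_ex)

lemma dec_enc_trm [simp]: "dec_trm (enc t) = t"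
  using enc_dec_trm[of "enc t"] by (simp only: enc_eq_iff)

text \<open>Although \<open>dec_trm\<close> is defined by choice, it acts on codes as the
  identity.\<close>

lemma computable_dec_trm [computable_intros]:
  assumes "computable f"
  shows "computable (\<lambda>x. dec_trm (f x))"
  using assms by (rule computable_recode) simp

section \<open>One-step rewriting is computable\<close>

lemma subst_cong: "(\<And>x. x \<in> vars t \<Longrightarrow> \<sigma> x = \<tau> x) \<Longrightarrow> subst \<sigma> t = subst \<tau> t"
  by (induction t) auto

lemma computable_subst:
  assumes "\<And>x. x \<in> vars r \<Longrightarrow> computable (g x)"
  shows "computable (\<lambda>t. subst (\<lambda>x. g x t) r)"
  using assms
proof (induction r)
  case (Var x)
  then show ?case by simp
next
  case (Fun f rs)
  have "computable (\<lambda>t. map (subst (\<lambda>x. g x t)) us)" if "set us \<subseteq> set rs" for us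
    using that
  proof (induction us)
    case Nil
    show ?case by (simp add: computable_const)
  next
    case (Cons u us)
    then show ?case using Fun by (auto intro!: computable_Cons)
  qed
  then show ?case by (auto intro!: computable_Fun computable_const)
qed

text \<open>The path to one occurrence of \<open>x\<close> in the fixed term \<open>l\<close> is
  built into \<open>g\<close>. On terms that are not instances of \<open>l\<close> its value carries
  no meaning.\<close>

lemma computable_binding:
  assumes "x \<in> vars l"
  shows "\<exists>g. computable g \<and> (\<forall>\<sigma>. g (subst \<sigma> l) = \<sigma> x)"
  using assms
proof (induction l)
  case (Var y)
  then show ?case using computable_id by auto
next
  case (Fun f ls)
  then obtain i where i: "i < length ls" "x \<in> vars (ls ! i)"
    by (auto simp: in_set_conv_nth)
  with Fun.IH obtain g where g: "computable g" "\<forall>\<sigma>. g (subst \<sigma> (ls ! i)) = \<sigma> x"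
    by (meson nth_mem)
  have "computable (\<lambda>t. g (hd (drop i (args t))))"
    by (intro computable_compose[OF g(1)] computable_intros)
  moreover have "g (hd (drop i (args (subst \<sigma> (Fun f ls))))) = \<sigma> x" for \<sigma>
    using i g(2) by (simp add: hd_drop_conv_nth)
  ultimately show ?case by (intro exI[of _ "\<lambda>t. g (hd (drop i (args t)))"]) simp
qed

text \<open>Matching is guess and check: the only candidate substitution is read off at fixed
  positions, and comparing the instance of \<open>l\<close> with \<open>t\<close> decides whether it
  matches. This also settles repeated variables in \<open>l\<close>. The variable condition ensures
  that the candidate determines the instance of \<open>r\<close>.\<close>

lemma computable_rule_instances:
  assumes "vars r \<subseteq> vars l"
  shows "\<exists>\<rho>. computable \<rho> \<and> (\<forall>t. set (\<rho> t) = {s. \<exists>\<sigma>. t = subst \<sigma> l \<and> s = subst \<sigma> r})"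
proof -
  obtain g where g: "\<And>x. x \<in> vars l \<Longrightarrow> computable (g x)"
    "\<And>x \<sigma>. x \<in> vars l \<Longrightarrow> g x (subst \<sigma> l) = \<sigma> x"
    using computable_binding[of _ l] by metis
  let ?\<rho> = "\<lambda>t. if subst (\<lambda>x. g x t) l = t then [subst (\<lambda>x. g x t) r] else []"
  have "computable ?\<rho>"
    using assms g(1) by (intro computable_intros computable_subst) auto
  moreover have "subst (\<lambda>x. g x (subst \<sigma> l)) l = subst \<sigma> l"
    "subst (\<lambda>x. g x (subst \<sigma> l)) r = subst \<sigma> r" for \<sigma>
    using assms by (auto intro!: subst_cong g(2))
  then have "set (?\<rho> t) = {s. \<exists>\<sigma>. t = subst \<sigma> l \<and> s = subst \<sigma> r}" for t
    by auto metis+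
  ultimately show ?thesis by blast
qed

lemma computable_root_steps:
  assumes "finite R" and "\<forall>(l, r) \<in> R. vars r \<subseteq> vars l"
  shows "\<exists>\<rho>. computable \<rho> \<and> (\<forall>t. set (\<rho> t) = {s. \<exists>(l, r) \<in> R. \<exists>\<sigma>. t = subst \<sigma> l \<and> s = subst \<sigma> r})"
  using assms
proof (induction R)
  case empty
  show ?case using computable_const[of "[] :: trm list"] by force
next
  case (insert rl R)
  obtain l r where rl: "rl = (l, r)" by (cases rl)
  obtain \<rho> where \<rho>: "computable \<rho>" "\<And>t. set (\<rho> t) = {s. \<exists>(l, r) \<in> R. \<exists>\<sigma>. t = subst \<sigma> l \<and> s = subst \<sigma> r}"
    using insert by auto
  obtain \<rho>' where \<rho>': "computable \<rho>'" "\<And>t. set (\<rho>' t) = {s. \<exists>\<sigma>. t = subst \<sigma> l \<and> s = subst \<sigma> r}"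
    using computable_rule_instances[of r l] insert.prems rl by auto
  have "computable (\<lambda>t. \<rho>' t @ \<rho> t)" by (intro computable_append \<rho> \<rho>')
  moreover have "set (\<rho>' t @ \<rho> t) = {s. \<exists>(l, r) \<in> insert rl R. \<exists>\<sigma>. t = subst \<sigma> l \<and> s = subst \<sigma> r}" for t
    by (auto simp: \<rho>(2) \<rho>'(2) rl)
  ultimately show ?case by blast
qed

text \<open>Each argument comes paired with the list of its successors.\<close>

primrec arg_succs :: "('a \<times> 'a list) list \<Rightarrow> 'a list list" where
  "arg_succs [] = []"
| "arg_succs (p # ps) = map (\<lambda>s. s # map fst ps) (snd p) @ map (\<lambda>us. fst p # us) (arg_succs ps)"

lemma set_arg_succs:
  "set (arg_succs (map (\<lambda>t. (t, F t)) ts)) = {us @ s # vs |us t s vs. ts = us @ t # vs \<and> s \<in> set (F t)}"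
proof (induction ts)
  case (Cons t ts)
  have "{us @ s # vs |us t' s vs. t # ts = us @ t' # vs \<and> s \<in> set (F t')} =
    {s # ts |s. s \<in> set (F t)} \<union> (#) t ` {us @ s # vs |us t s vs. ts = us @ t # vs \<and> s \<in> set (F t)}"
    (is "?A = ?B \<union> ?C")
  proof (intro equalityI subsetI)
    fix w assume "w \<in> ?A"
    then obtain us t' s vs where *: "t # ts = us @ t' # vs" "s \<in> set (F t')" "w = us @ s # vs" by auto
    show "w \<in> ?B \<union> ?C"
    proof (cases us)
      case (Cons u us')
      with * have "ts = us' @ t' # vs" "w = t # (us' @ s # vs)" by auto
      with *(2) show ?thesis by blast
    qed (use * in auto)
  next
    fix w assume "w \<in> ?B \<union> ?C"
    then show "w \<in> ?A"
    proof
      assume "w \<in> ?B"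
      then obtain s where "t # ts = [] @ t # ts" "s \<in> set (F t)" "w = [] @ s # ts" by auto
      then show ?thesis by blast
    next
      assume "w \<in> ?C"
      then obtain us t' s vs where "t # ts = (t # us) @ t' # vs" "s \<in> set (F t')" "w = (t # us) @ s # vs"
        by auto
      then show ?thesis by blast
    qed
  qed
  with Cons show ?case by (auto simp: image_iff comp_def)
qed auto

lemma computable_arg_succs [computable_intros]:
  assumes "computable f"
  shows "computable (\<lambda>x. arg_succs (f x))"
proof -
  have "computable (\<lambda>x. rec_list []
    (\<lambda>p ps r. map (\<lambda>s. s # map fst ps) (snd p) @ map (\<lambda>us. fst p # us) r) (f x))"
    by (intro computable_rec_list computable_intros assms)
  moreover have "rec_list [] (\<lambda>p ps r. map (\<lambda>s. s # map fst ps) (snd p) @ map (\<lambda>us. fst p # us) r) xs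
    = arg_succs xs" for xs :: "('b \<times> 'b list) list"
    by (induction xs) auto
  ultimately show ?thesis by simp
qed

fun succs :: "(trm \<Rightarrow> trm list) \<Rightarrow> trm \<Rightarrow> trm list" where
  "succs \<rho> (Var x) = \<rho> (Var x)"
| "succs \<rho> (Fun f ts) = \<rho> (Fun f ts) @ map (Fun f) (arg_succs (map (\<lambda>t. (t, succs \<rho> t)) ts))"

lemma set_succs:
  assumes \<rho>: "\<And>t. set (\<rho> t) = {s. \<exists>(l, r) \<in> R. \<exists>\<sigma>. t = subst \<sigma> l \<and> s = subst \<sigma> r}"
  shows "set (succs \<rho> t) = {s. rstep R t s}"
proof (induction t)
  case (Var x)
  have "\<exists>(l, r) \<in> R. \<exists>\<sigma>. Var x = subst \<sigma> l \<and> s = subst \<sigma> r" if "rstep R (Var x) s" for s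
    using that
  proof cases
    case (root l r \<sigma>)
    then show ?thesis by blast
  qed
  then show ?case by (auto simp: \<rho>) (metis rstep.root)
next
  case (Fun f ts)
  have args: "set (arg_succs (map (\<lambda>t. (t, succs \<rho> t)) ts)) = {us @ s # vs |us t s vs. ts = us @ t # vs \<and> rstep R t s}"
    unfolding set_arg_succs using Fun by fastforce
  have steps: "rstep R (Fun f ts) s \<longleftrightarrow> (\<exists>(l, r) \<in> R. \<exists>\<sigma>. Fun f ts = subst \<sigma> l \<and> s = subst \<sigma> r) \<or>
    (\<exists>us t t' vs. ts = us @ t # vs \<and> rstep R t t' \<and> s = Fun f (us @ t' # vs))" for s
  proof
    assume "rstep R (Fun f ts) s"
    then show "(\<exists>(l, r) \<in> R. \<exists>\<sigma>. Fun f ts = subst \<sigma> l \<and> s = subst \<sigma> r) \<or>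
      (\<exists>us t t' vs. ts = us @ t # vs \<and> rstep R t t' \<and> s = Fun f (us @ t' # vs))"
    proof cases
      case (root l r \<sigma>)
      then show ?thesis by blast
    next
      case (arg t t' us vs)
      then show ?thesis by blast
    qed
  next
    assume "(\<exists>(l, r) \<in> R. \<exists>\<sigma>. Fun f ts = subst \<sigma> l \<and> s = subst \<sigma> r) \<or>
      (\<exists>us t t' vs. ts = us @ t # vs \<and> rstep R t t' \<and> s = Fun f (us @ t' # vs))"
    then show "rstep R (Fun f ts) s"
      by (auto intro: rstep.arg) (metis rstep.root)
  qed
  show ?case unfolding succs.simps set_append set_map args \<rho> steps by blast
qed

text \<open>\<open>succs\<close> recurses through the arguments; on codes this is course-of-values
  recursion, where entry \<open>enc u\<close> of the table \<open>T\<close> holds the successors of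
  an argument \<open>u\<close>.\<close>

lemma computable_succs:
  assumes \<rho>: "computable \<rho>"
  shows "computable (succs \<rho>)"
proof -
  let ?H = "\<lambda>n T. let t = dec_trm n in \<rho> t @ (if is_Fun t then
    map (Fun (root_symb t)) (arg_succs (map (\<lambda>u. (u, hd (drop (enc u) T))) (args t))) else [])"
  have "computable (\<lambda>n. succs \<rho> (dec_trm n))"
  proof (rule computable_course_of_values)
    show "computable (\<lambda>p. ?H (fst p) (snd p))"
      unfolding Let_def by (intro computable_intros computable_compose[OF \<rho>])
    fix n
    show "succs \<rho> (dec_trm n) = ?H n (map (\<lambda>n. succs \<rho> (dec_trm n)) [0..<n])"
    proof (cases "dec_trm n")
      case (Var x)
      then show ?thesis by simp
    next
      case (Fun f ts)
      then have "enc (Fun f ts) = n" by (metis enc_dec_trm)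
      then have "enc u < n" if "u \<in> set ts" for u
        using enc_arg_less[OF that] by metis
      then have *: "map (\<lambda>u. (u, hd (drop (enc u) (map (\<lambda>n. succs \<rho> (dec_trm n)) [0..<n])))) ts
        = map (\<lambda>u. (u, succs \<rho> u)) ts"
        by (auto simp: hd_drop_conv_nth)
      then show ?thesis by (simp only: Fun Let_def is_Fun.simps root_symb.simps args.simps succs.simps * if_True)
    qed
  qed
  then have "computable (\<lambda>t. succs \<rho> (dec_trm (enc (t :: trm))))"
    by (rule computable_compose) (intro computable_intros)
  then show ?thesis by simp
qed

lemma computable_rstep:
  assumes "trs R"
  shows "\<exists>S. computable S \<and> (\<forall>t. set (S t) = {s. rstep R t s})"
proof -
  obtain \<rho> where "computable \<rho>"
    "\<And>t. set (\<rho> t) = {s. \<exists>(l, r) \<in> R. \<exists>\<sigma>. t = subst \<sigma> l \<and> s = subst \<sigma> r}"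
    using computable_root_steps[of R] assms unfolding trs_def by blast
  then show ?thesis using computable_succs set_succs by blast
qed

section \<open>Descendants under a terminating rewrite system\<close>

lemma Fun_in_terms_iff:
  "Fun f ts \<in> terms \<Sigma> X \<longleftrightarrow> f \<in> \<Sigma> \<and> length ts = rank f \<and> set ts \<subseteq> terms \<Sigma> X"
  by (auto intro: terms.Fun elim: terms.cases)

lemma subst_in_terms_vars: "subst \<sigma> l \<in> terms \<Sigma> X \<Longrightarrow> x \<in> vars l \<Longrightarrow> \<sigma> x \<in> terms \<Sigma> X"
  by (induction l) (auto simp: Fun_in_terms_iff)

lemma subst_in_terms:
  "r \<in> terms UNIV UNIV \<Longrightarrow> symbols r \<subseteq> \<Sigma> \<Longrightarrow> (\<And>x. x \<in> vars r \<Longrightarrow> \<sigma> x \<in> terms \<Sigma> X)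
    \<Longrightarrow> subst \<sigma> r \<in> terms \<Sigma> X"
proof (induction r)
  case (Fun f ts)
  then show ?case by (fastforce simp: Fun_in_terms_iff)
qed simp

lemma rstep_in_terms:
  assumes "trs R" "sign R \<subseteq> \<Sigma>" "rstep R s t" "s \<in> terms \<Sigma> X"
  shows "t \<in> terms \<Sigma> X"
  using assms(3,4)
proof induction
  case (root l r \<sigma>)
  then have "r \<in> terms UNIV UNIV" "vars r \<subseteq> vars l" "symbols r \<subseteq> \<Sigma>"
    using assms(1,2) unfolding trs_def sign_def by fastforce+
  then show ?case
    using subst_in_terms_vars[OF root.prems] by (intro subst_in_terms) auto
next
  case (arg s t f us vs)
  then show ?case by (auto simp: Fun_in_terms_iff)
qed

text \<open>A path of \<open>m\<close> steps has an initial segment of \<open>n\<close>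
  steps.\<close>

lemma relpowp_empty_mono:
  fixes r :: "'a \<Rightarrow> 'a \<Rightarrow> bool"
  assumes "\<And>s. \<not> (r ^^ n) t s" "n \<le> m"
  shows "\<not> (r ^^ m) t s"
  using assms relpowp_add[of n "m - n" r] by auto

text \<open>Koenig's lemma, by well-founded induction: a bound for \<open>t\<close> is one more than
  the largest of the bounds for its finitely many successors.\<close>

lemma terminating_bounded:
  assumes "trs R" "terminating R" "t \<in> terms UNIV UNIV"
  shows "\<exists>n. \<forall>s. \<not> (rstep R ^^ n) t s"
proof -
  \<comment> \<open>The reduct is the smaller element. Correct ranking is part of the relation
    because \<open>terminating\<close> only excludes infinite sequences of correctly ranked
    terms.\<close>
  let ?r = "{(s, t). rstep R t s \<and> t \<in> terms UNIV UNIV}"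
  have "wf ?r"
    unfolding wf_iff_no_infinite_down_chain using assms(2) unfolding terminating_def by auto
  then show ?thesis using assms(3)
  proof (induction t)
    case (less t)
    obtain S where S: "\<And>t. set (S t) = {s. rstep R t s}"
      using computable_rstep[OF assms(1)] by blast
    have "\<exists>n. \<forall>s. \<not> (rstep R ^^ n) u s" if "rstep R t u" for u
      using less that rstep_in_terms[OF assms(1) _ that less.prems] by auto
    then obtain n where n: "\<And>u s. rstep R t u \<Longrightarrow> \<not> (rstep R ^^ n u) u s" by metis
    \<comment> \<open>If \<open>t\<close> has no successor, this maximum over the empty set is
      unspecified, but then there is no first step to bound.\<close>
    let ?N = "Max (n ` set (S t))"
    have "\<not> (rstep R ^^ ?N) u s" if "rstep R t u" for u s
      using n[OF that] by (rule relpowp_empty_mono) (intro Max_ge finite_imageI finite_set imageI, simp add: S that)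
    then have "\<not> (rstep R ^^ Suc ?N) t s" for s
      by (auto simp del: relpowp.simps dest!: relpowp_Suc_D2)
    then show ?case by blast
  qed
qed

definition level :: "(trm \<Rightarrow> trm list) \<Rightarrow> nat \<Rightarrow> trm list \<Rightarrow> trm list" where
  "level S n ts = ((\<lambda>ts. concat (map S ts)) ^^ n) ts"

lemma computable_level:
  assumes "computable S" "computable n" "computable ts"
  shows "computable (\<lambda>x. level S (n x) (ts x))"
  unfolding level_def
  by (intro computable_funpow computable_intros computable_compose[OF assms(1)] assms(2,3))

lemma set_level:
  assumes "\<And>t. set (S t) = {s. rstep R t s}"
  shows "set (level S n ts) = {s. \<exists>t \<in> set ts. (rstep R ^^ n) t s}"
  by (induction n) (auto simp: level_def assms)

lemma level_eventually_empty:
  assumes S: "\<And>t. set (S t) = {s. rstep R t s}"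
    and R: "trs R" "terminating R" and ts: "set ts \<subseteq> terms UNIV UNIV"
  shows "\<exists>n. level S n ts = []"
proof -
  have "\<exists>n. \<forall>s. \<not> (rstep R ^^ n) t s" if "t \<in> set ts" for t
    using terminating_bounded[OF R] ts that by blast
  then obtain n where n: "\<And>t s. t \<in> set ts \<Longrightarrow> \<not> (rstep R ^^ n t) t s" by metis
  let ?N = "Max (n ` set ts)"
  have "\<not> (rstep R ^^ ?N) t s" if "t \<in> set ts" for t s
    using n[OF that] by (rule relpowp_empty_mono) (simp add: that)
  then have "set (level S ?N ts) = {}" by (auto simp: set_level[OF S])
  then show ?thesis by auto
qed

text \<open>An empty level has only empty levels after it, so no derivation from \<open>ts\<close>
  has \<open>n\<close> or more steps.\<close>

lemma descendants_eq_levels: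
  assumes S: "\<And>t. set (S t) = {s. rstep R t s}" and n: "level S n ts = []"
  shows "descendants R (set ts) = set (concat (map (\<lambda>k. level S k ts) [0..<n]))"
proof -
  have lt: "k < n" if "t \<in> set ts" "(rstep R ^^ k) t s" for k t s
  proof (rule ccontr)
    assume "\<not> k < n"
    moreover have "\<not> (rstep R ^^ n) t s" for s
      using set_level[OF S, of n ts] that(1) n by auto
    ultimately show False using relpowp_empty_mono[of n "rstep R" t k] that(2) by auto
  qed
  then show ?thesis
    unfolding descendants_def rtranclp_power
    by (auto simp: set_level[OF S] atLeast0LessThan)
qed

section \<open>An automaton recognizing a finite set of ground terms\<close>

text \<open>The states are the codes below \<open>N\<close>, shifted by \<open>m\<close> to keep them apart from the alphabet;
  a ground term with code \<open>k < N\<close> evaluates exactly to the state of \<open>k\<close>.\<close>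

definition state :: "nat \<Rightarrow> nat \<Rightarrow> symb" where
  "state m k = (m + k, 0)"

definition eval_rule :: "nat \<Rightarrow> trm \<Rightarrow> rule" where
  "eval_rule m t =
    (Fun (root_symb t) (map (\<lambda>u. const (state m (enc u))) (args t)), const (state m (enc t)))"

text \<open>Only the root is checked, so the test needs no recursion. The resulting rules for terms
  with ill-formed arguments are harmless: by the invariant \<open>val\<close>, a ground term reaches
  no state but the one naming it.\<close>

definition ranked_root :: "symb set \<Rightarrow> trm \<Rightarrow> bool" where
  "ranked_root \<Sigma> t \<longleftrightarrow> is_Fun t \<and> root_symb t \<in> \<Sigma> \<and> length (args t) = rank (root_symb t)"

definition finite_bta :: "symb set \<Rightarrow> nat \<Rightarrow> nat \<Rightarrow> trm set \<Rightarrow> bta" where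
  "finite_bta \<Sigma> m N D = \<lparr>alphabet = \<Sigma>, states = state m ` {..<N}, finals = (\<lambda>t. state m (enc t)) ` D,
    rules = eval_rule m ` {t. enc t < N \<and> ranked_root \<Sigma> t}\<rparr>"

lemma finite_enc_less: "finite {t :: 'a::encodable. enc t < N}"
  using finite_vimageI[OF finite_lessThan[of N] inj_enc] by (simp add: vimage_def)

lemma wf_finite_bta:
  assumes "finite \<Sigma>" "\<forall>f \<in> \<Sigma>. fst f < m" "\<forall>t \<in> D. enc t < N"
  shows "wf_bta (finite_bta \<Sigma> m N D)"
proof -
  have "\<exists>\<delta> as a. \<delta> \<in> \<Sigma> \<and> length as = rank \<delta> \<and> set as \<subseteq> state m ` {..<N} \<and> a \<in> state m ` {..<N} \<and>
      eval_rule m t = (Fun \<delta> (map const as), const a)" if t: "enc t < N" "ranked_root \<Sigma> t" for t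
  proof -
    obtain f ts where "t = Fun f ts" using t(2) by (cases t) (auto simp: ranked_root_def)
    moreover have "enc u < N" if "u \<in> set ts" for u
      using enc_arg_less[OF that, of f] t(1) calculation by simp
    ultimately show ?thesis using t
      by (intro exI[of _ f] exI[of _ "map (\<lambda>u. state m (enc u)) ts"] exI[of _ "state m (enc t)"])
        (auto simp: ranked_root_def eval_rule_def)
  qed
  moreover have "state m k \<notin> \<Sigma>" for k using bspec[OF assms(2), of "state m k"] by (auto simp: state_def)
  ultimately show ?thesis
    using assms(1,3) finite_enc_less[of N, where 'a = trm]
    unfolding wf_bta_def finite_bta_def by (auto simp: state_def)
qed

text \<open>Reads a term mixing input symbols and states as the term it stands for, each state being
  replaced by the term it names. Automaton steps preserve the reading, which gives
  soundness.\<close>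

fun val :: "symb set \<Rightarrow> nat \<Rightarrow> trm \<Rightarrow> trm" where
  "val \<Sigma> m (Var x) = Var x"
| "val \<Sigma> m (Fun f ts) = (if f \<in> \<Sigma> then Fun f (map (val \<Sigma> m) ts) else dec_trm (fst f - m))"

lemma val_ground: "t \<in> ground_terms \<Sigma> \<Longrightarrow> val \<Sigma> m t = t"
  by (induction rule: terms.induct) (auto intro: map_idI)

lemma val_state:
  assumes "\<forall>f \<in> \<Sigma>. fst f < m"
  shows "val \<Sigma> m (const (state m k)) = dec_trm k"
  using bspec[OF assms, of "state m k"] by (auto simp: state_def)

text \<open>Both sides of \<open>eval_rule m t\<close> read as \<open>t\<close>, whatever the
  substitution, since the rules have no variables.\<close>

lemma val_rstep:
  assumes \<Sigma>: "\<forall>f \<in> \<Sigma>. fst f < m" and "rstep (rules (finite_bta \<Sigma> m N D)) s t"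
  shows "val \<Sigma> m s = val \<Sigma> m t"
  using assms(2)
proof induction
  case (root l r \<sigma>)
  then obtain t where t: "ranked_root \<Sigma> t" "eval_rule m t = (l, r)"
    unfolding finite_bta_def by auto
  then obtain f ts where "t = Fun f ts" by (cases t) (auto simp: ranked_root_def)
  with t have *: "f \<in> \<Sigma>" "l = Fun f (map (\<lambda>u. const (state m (enc u))) ts)" "r = const (state m (enc t))"
    "t = Fun f ts"
    by (auto simp: ranked_root_def eval_rule_def)
  have "val \<Sigma> m (subst \<sigma> l) = Fun f (map (\<lambda>u. val \<Sigma> m (const (state m (enc u)))) ts)"
    using * by (simp add: comp_def)
  also have "\<dots> = t" unfolding val_state[OF \<Sigma>] using * by simp
  finally have "val \<Sigma> m (subst \<sigma> l) = t" .
  moreover have "val \<Sigma> m (subst \<sigma> r) = t"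
    using *(3) val_state[OF \<Sigma>] by (simp del: val.simps(2))
  ultimately show ?case by simp
qed simp

lemma rsteps_arg: "(rstep R)\<^sup>*\<^sup>* s t \<Longrightarrow> (rstep R)\<^sup>*\<^sup>* (Fun f (us @ s # vs)) (Fun f (us @ t # vs))"
  by (induction rule: rtranclp_induct) (auto intro: rtranclp.rtrancl_into_rtrancl rstep.arg)

text \<open>\<open>us\<close> collects the arguments already rewritten, which the induction from
  left to right requires.\<close>

lemma rsteps_args:
  assumes "\<And>t. t \<in> set ts \<Longrightarrow> (rstep R)\<^sup>*\<^sup>* t (g t)"
  shows "(rstep R)\<^sup>*\<^sup>* (Fun f (us @ ts)) (Fun f (us @ map g ts))"
  using assms
proof (induction ts arbitrary: us)
  case (Cons t ts)
  have "(rstep R)\<^sup>*\<^sup>* (Fun f (us @ t # ts)) (Fun f (us @ g t # ts))"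
    using Cons.prems by (intro rsteps_arg) simp
  also have "(rstep R)\<^sup>*\<^sup>* (Fun f (us @ g t # ts)) (Fun f (us @ g t # map g ts))"
    using Cons.IH[of "us @ [g t]"] Cons.prems by simp
  finally show ?case by simp
qed simp

lemma rsteps_state:
  assumes "t \<in> ground_terms \<Sigma>" "enc t < N"
  shows "(rstep (rules (finite_bta \<Sigma> m N D)))\<^sup>*\<^sup>* t (const (state m (enc t)))"
  using assms
proof (induction rule: terms.induct)
  case (Fun f ts)
  let ?R = "rules (finite_bta \<Sigma> m N D)"
  let ?l = "Fun f (map (\<lambda>u. const (state m (enc u))) ts)" and ?r = "const (state m (enc (Fun f ts)))"
  have "enc t < N" if "t \<in> set ts" for t
    using enc_arg_less[OF that, of f] Fun.prems by simp
  then have "(rstep ?R)\<^sup>*\<^sup>* (Fun f ([] @ ts)) (Fun f ([] @ map (\<lambda>u. const (state m (enc u))) ts))"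
    using Fun.IH by (intro rsteps_args) auto
  moreover have "(?l, ?r) = eval_rule m (Fun f ts)" by (simp add: eval_rule_def)
  then have "(?l, ?r) \<in> ?R"
    using Fun.hyps Fun.prems unfolding finite_bta_def by (auto simp: ranked_root_def)
  then have "rstep ?R (subst Var ?l) (subst Var ?r)" by (rule rstep.root)
  ultimately show ?case by (simp add: comp_def)
qed simp

text \<open>Ground terms read as themselves and the state of \<open>d\<close> reads as
  \<open>d\<close>, so a ground term that reaches this state is \<open>d\<close>. The other
  inclusion is bottom-up evaluation.\<close>

lemma lang_finite_bta:
  assumes \<Sigma>: "\<forall>f \<in> \<Sigma>. fst f < m" and N: "\<forall>t \<in> D. enc t < N"
    and D: "D \<subseteq> ground_terms \<Sigma>"
  shows "lang (finite_bta \<Sigma> m N D) = D"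
proof (intro equalityI subsetI)
  let ?C = "finite_bta \<Sigma> m N D"
  have sel: "alphabet ?C = \<Sigma>" "finals ?C = (\<lambda>t. state m (enc t)) ` D" by (simp_all add: finite_bta_def)
  show "t \<in> lang ?C" if "t \<in> D" for t
    using that rsteps_state[of t \<Sigma> N m D] N D unfolding lang_def sel by auto
  fix t assume "t \<in> lang ?C"
  then obtain d where d: "t \<in> ground_terms \<Sigma>" "d \<in> D" "(rstep (rules ?C))\<^sup>*\<^sup>* t (const (state m (enc d)))"
    unfolding lang_def sel by auto
  from d(3) have "val \<Sigma> m t = val \<Sigma> m (const (state m (enc d)))"
    by (induction rule: rtranclp_induct) (auto dest: val_rstep[OF \<Sigma>])
  also have "\<dots> = d" by (simp add: val_state[OF \<Sigma>] del: val.simps)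
  finally show "t \<in> D" using d by (simp add: val_ground)
qed

section \<open>Computing the automaton\<close>

text \<open>A member \<open>k\<close> of the set coded by \<open>c\<close> contributes
  \<open>2 ^ k\<close> to \<open>c\<close> and is therefore less than \<open>c\<close>, so the scan
  below \<open>c\<close> misses nothing.\<close>

definition decode_terms :: "nat \<Rightarrow> trm list" where
  "decode_terms c = map dec_trm (filter (\<lambda>k. k \<in> set_decode c) [0..<c])"

lemma elem_less_set_encode:
  assumes "finite A" "x \<in> A"
  shows "x < set_encode A"
proof -
  have "2 ^ x \<le> set_encode A"
    unfolding set_encode_def using assms by (intro member_le_sum) auto
  then show ?thesis using less_exp[of x] by linarith
qed

lemma set_decode_terms:
  assumes "finite L"
  shows "set (decode_terms (trms_code L)) = L"
proof -
  have "finite (enc ` L)" using assms by simp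
  moreover have "trms_code L = set_encode (enc ` L)" by (simp add: trms_code_def enc_trm_def)
  ultimately have "set (decode_terms (trms_code L)) = dec_trm ` enc ` L"
    unfolding decode_terms_def by (auto dest: elem_less_set_encode)
  then show ?thesis by (simp add: image_image)
qed

text \<open>The fields of \<open>finite_bta\<close> with sets replaced by lists. The number
  \<open>c\<close> acts both as the code of the alphabet, passed on unchanged, and as the shift of
  the states; \<open>enc D\<close> is the bound on codes.\<close>

definition bta_codes :: "nat \<Rightarrow> trm list \<Rightarrow> nat list" where
  "bta_codes c D =
    [c, set_encode (set (map (\<lambda>k. enc (state c k)) [0..<enc D])),
     set_encode (set (map (\<lambda>t. enc (state c (enc t))) D)),
     set_encode (set (map (\<lambda>t. enc (eval_rule c t)) (filter
       (\<lambda>t. is_Fun t \<and> enc (root_symb t) \<in> set_decode c \<and> length (args t) = rank (root_symb t))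
       (map dec_trm [0..<enc D]))))]"

lemma computable_bta_codes:
  assumes "computable c" "computable D"
  shows "computable (\<lambda>x. bta_codes (c x) (D x))"
proof -
  note c = computable_compose[OF assms(1)] and D = computable_compose[OF assms(2)]
  show ?thesis
    unfolding bta_codes_def state_def eval_rule_def by (intro computable_intros c D assms)
qed

lemma enc_bta_codes:
  assumes "finite \<Sigma>"
  shows "enc (bta_codes (symbs_code \<Sigma>) D) = bta_code (finite_bta \<Sigma> (symbs_code \<Sigma>) (enc D) (set D))"
proof -
  define c where "c = symbs_code \<Sigma>"
  have c: "set_encode (prod_encode ` \<Sigma>) = c" by (simp add: c_def symbs_code_def)
  have "set_decode c = prod_encode ` \<Sigma>" using assms by (simp add: c_def symbs_code_def)
  then have mem: "enc f \<in> set_decode c \<longleftrightarrow> f \<in> \<Sigma>" for f :: symb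
    by (auto simp: enc_symb)
  \<comment> \<open>Numbers below \<open>enc D\<close> and terms with code below
    \<open>enc D\<close> correspond one to one, because the coding of terms is bijective.\<close>
  have rules: "{t. enc t < enc D \<and> ranked_root \<Sigma> t} = set (filter
       (\<lambda>t. is_Fun t \<and> enc (root_symb t) \<in> set_decode c \<and> length (args t) = rank (root_symb t))
       (map dec_trm [0..<enc D]))"
    unfolding mem ranked_root_def by (force simp: image_iff intro: dec_enc_trm[symmetric])
  have codes: "enc xs = list_encode xs" for xs :: "nat list"
    by (simp add: enc_list_def map_idI)
  show ?thesis
    unfolding c_def[symmetric] bta_codes_def bta_code_def finite_bta_def codes rules
    by (simp add: rules_code_def symbs_code_def c image_image enc_symb enc_rule
        lessThan_atLeast0 del: set_filter)
qed

theorem mainTheorem11: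
  fixes R :: "rule set"
  assumes "trs R" and "terminating R"
  shows "EPRF R"
proof -
  obtain S where S: "computable S" "\<And>t. set (S t) = {s. rstep R t s}"
    using computable_rstep[OF assms(1)] by blast
  define inp where "inp x = decode_terms (snd x)" for x :: "nat \<times> nat"
  define desc where "desc x n = concat (map (\<lambda>k. level S k (inp x)) [0..<n])" for x n
  have inp: "computable inp"
    unfolding inp_def decode_terms_def by (intro computable_intros)
  note level = computable_level[OF S(1)] computable_compose[OF inp]
  \<comment> \<open>Only the empty list has code 0, so the search for a zero stops at the first
    empty level.\<close>
  obtain e where e: "\<And>x. \<exists>n. enc (level S n (inp x)) = 0 \<Longrightarrow>
    computes e [enc x] (enc (bta_codes (fst x) (desc x (LEAST n. enc (level S n (inp x)) = 0))))"
    using computes_search[of "\<lambda>x n. enc (level S n (inp x))" "\<lambda>x n. bta_codes (fst x) (desc x n)"]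
    unfolding desc_def by (force intro: computable_intros level computable_bta_codes)
  have "\<exists>C. wf_bta C \<and> alphabet C = \<Sigma> \<and> lang C = descendants R L \<and>
      computes (Comp e [rec_pair]) [symbs_code \<Sigma>, trms_code L] (bta_code C)"
    if \<Sigma>: "finite \<Sigma>" "sign R \<subseteq> \<Sigma>" and L: "finite L" "L \<subseteq> ground_terms \<Sigma>" for \<Sigma> L
  proof -
    let ?x = "(symbs_code \<Sigma>, trms_code L)"
    let ?n = "LEAST n. level S n (inp ?x) = []"
    let ?D = "desc ?x ?n"
    \<comment> \<open>Both constants come for free: the code of \<open>\<Sigma>\<close> exceeds
      every name in it, and the code of the list \<open>?D\<close> exceeds the code of each of its
      members.\<close>
    let ?C = "finite_bta \<Sigma> (symbs_code \<Sigma>) (enc ?D) (set ?D)"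
    have inp_L: "set (inp ?x) = L" by (simp add: inp_def set_decode_terms L)
    have "t \<in> terms UNIV UNIV" if "t \<in> ground_terms \<Sigma>" for t
      using that by (induction rule: terms.induct) (auto intro: terms.intros)
    then have ex: "\<exists>n. level S n (inp ?x) = []"
      using L(2) by (intro level_eventually_empty[OF S(2) assms]) (auto simp: inp_L)
    have D: "set ?D = descendants R L"
      unfolding desc_def using descendants_eq_levels[OF S(2) LeastI_ex[OF ex]] by (simp add: inp_L)
    have ground: "set ?D \<subseteq> ground_terms \<Sigma>"
    proof
      fix p assume "p \<in> set ?D"
      then obtain q where q: "q \<in> L" "(rstep R)\<^sup>*\<^sup>* q p" unfolding D descendants_def by blast
      from q(2) show "p \<in> ground_terms \<Sigma>"
        using q(1) L(2) by (induction rule: rtranclp_induct) (auto intro: rstep_in_terms[OF assms(1) \<Sigma>(2)])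
    qed
    have "fst f < symbs_code \<Sigma>" if "f \<in> \<Sigma>" for f
      using elem_less_set_encode[of "prod_encode ` \<Sigma>" "prod_encode f"] that \<Sigma>(1)
        le_prod_encode_1[of "fst f" "snd f"] by (simp add: symbs_code_def)
    then have names: "\<forall>f \<in> \<Sigma>. fst f < symbs_code \<Sigma>" by blast
    have N: "\<forall>t \<in> set ?D. enc t < enc ?D" using elem_less_enc by blast
    have "computes e [prod_encode ?x] (bta_code ?C)"
      using e[of ?x] ex by (simp add: enc_bta_codes \<Sigma>)
    \<comment> \<open>\<open>e\<close> expects its two inputs as one paired number.\<close>
    then have "computes (Comp e [rec_pair]) [symbs_code \<Sigma>, trms_code L] (bta_code ?C)"
      by (rule computes_Comp1[OF computes_pair])
    moreover have "wf_bta ?C" using \<Sigma>(1) names N by (rule wf_finite_bta)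
    moreover have "lang ?C = descendants R L"
      using lang_finite_bta[OF names N ground] D by simp
    moreover have "alphabet ?C = \<Sigma>" by (simp add: finite_bta_def)
    ultimately show ?thesis by blast
  qed
  then show ?thesis unfolding EPRF_def using assms(1) by blast
qed

end
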